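(* Let $\mathbb X,\mathbb Y$ be real Banach spaces, $C\subseteq\mathbb Y$ a closed convex cone with $\{0\}\neq C\neq\mathbb Y$, $K\subseteq\mathbb X$ a nonempty closed set and $f:\mathbb X\times\mathbb X\to\mathbb Y$. Let $\mathcal{SE}=\{\bar x\in K:\ f(\bar x,x)\in C\ \ \forall x\in K\}$ and $\nu(x)=\sup_{z\in K}\mathrm{dist}(f(x,z),C)\in[0,+\infty]$. Suppose that: (i) for every $z\in K$ the function $x\mapsto f(x,z)$ is $C$-u.s.c. on $K$; (ii) there exists $x_0\in K$ such that $f(x_0,K)=\{f(x_0,z):z\in K\}$ is $C$-bounded; (iii) $f(\cdot,z)$ is metrically $C$-increasing on $K\setminus\mathcal{SE}$, uniformly in $z\in K$. Then $\mathcal{SE}$ is nonempty and closed, and $$\mathrm{dist}(x,\mathcal{SE})\le\frac{\nu(x)}{\mathrm{inc}_C(f;K\setminus\mathcal{SE})-1},\qquad\forall x\in K.$$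
   Context: A mapping $g:\mathbb X\to\mathbb Y$ is $C$-u.s.c. at $x_0$ if for every neighbourhood $V$ of $g(x_0)$ there is a neighbourhood $U$ of $x_0$ in $\mathbb X$ with $g(x)\in V-C$ for all $x\in U$; it is $C$-u.s.c. on a set if it is so at each point of the set. A set $S\subseteq\mathbb Y$ is $C$-bounded if there is $m\ge0$ with $S\setminus C\subseteq m\mathbb B$, where $\mathbb B$ is the closed unit ball. $\mathrm{dist}(x,S)=\inf_{s\in S}\|x-s\|$, with $\mathrm{dist}(x,\varnothing)=+\infty$. For a point $x$, $\mathrm B(x,r)$ is the closed ball of radius $r$; for a set $A$, $\mathrm B(A,r)=\{y:\mathrm{dist}(y,A)\le r\}$. Given $S\subseteq\mathbb X$, $f$ is metrically $C$-increasing on $S$, uniformly in $z\in K$, if there exists $\alpha>1$ such that for every $x_0\in S$ there is $\delta_0>0$ (not depending on $z$) such that: for every $r\in(0,\delta_0)$ there is $x\in\mathrm B(x_0,r)\cap S$ with $\mathrm B(f(x,z),\alpha r)\subseteq\mathrm B(f(x_0,z)+C,r)$ for all $z\in K$. The supremum of all $\alpha>1$ for which this holds is denoted $\mathrm{inc}_C(f;S)\in(1,+\infty]$. Convention for the quotient: it equals $+\infty$ if $\nu(x)=+\infty$, and $0$ if $\nu(x)<+\infty$ and the denominator is $+\infty$. *)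

theory Defs
  imports "HOL-Analysis.Analysis"
begin

(* Unlike infdist, which is 0 for the empty set, the value here is \<infinity> when S = {}. *)
definition edist_set :: "'a::real_normed_vector \<Rightarrow> 'a set \<Rightarrow> ereal" where
  "edist_set x S = (INF s\<in>S. ereal (norm (x - s)))"

definition set_cball :: "'a::real_normed_vector set \<Rightarrow> real \<Rightarrow> 'a set" where
  "set_cball A r = {y. edist_set y A \<le> ereal r}"

(* V - C is the Minkowski difference; neighbourhoods of x0 are taken in the whole space. *)
definition C_usc_at ::
  "'b::real_normed_vector set \<Rightarrow> ('a::real_normed_vector \<Rightarrow> 'b) \<Rightarrow> 'a \<Rightarrow> bool" where
  "C_usc_at C g x0 \<longleftrightarrow>
     (\<forall>V. (\<forall>\<^sub>F y in nhds (g x0). y \<in> V) \<longrightarrow>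
          (\<forall>\<^sub>F x in nhds x0. g x \<in> {v - c | v c. v \<in> V \<and> c \<in> C}))"

definition C_usc_on ::
  "'b::real_normed_vector set \<Rightarrow> 'a::real_normed_vector set \<Rightarrow> ('a \<Rightarrow> 'b) \<Rightarrow> bool" where
  "C_usc_on C S g \<longleftrightarrow> (\<forall>x\<in>S. C_usc_at C g x)"

definition C_bounded :: "'b::real_normed_vector set \<Rightarrow> 'b set \<Rightarrow> bool" where
  "C_bounded C S \<longleftrightarrow> (\<exists>m\<ge>0. S - C \<subseteq> cball 0 m)"

definition strong_equilibria ::
  "'b set \<Rightarrow> 'a set \<Rightarrow> ('a \<Rightarrow> 'a \<Rightarrow> 'b) \<Rightarrow> 'a set" where
  "strong_equilibria C K f = {xbar \<in> K. \<forall>x\<in>K. f xbar x \<in> C}"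

definition merit ::
  "'b::real_normed_vector set \<Rightarrow> 'a set \<Rightarrow> ('a \<Rightarrow> 'a \<Rightarrow> 'b) \<Rightarrow> 'a \<Rightarrow> ereal" where
  "merit C K f x = (SUP z\<in>K. edist_set (f x z) C)"

(* The property required of a single constant \<alpha>: \<delta> may depend on x0 but not on z, and the point x
   chosen for a given r serves all z \<in> K at once. The image of C under (+) (f x0 z) is f(x0,z) + C. *)
definition metr_C_increasing_const ::
  "'b::real_normed_vector set \<Rightarrow> 'a::real_normed_vector set \<Rightarrow> ('a \<Rightarrow> 'a \<Rightarrow> 'b) \<Rightarrow> 'a set \<Rightarrow> real \<Rightarrow> bool"
  where
  "metr_C_increasing_const C K f S \<alpha> \<longleftrightarrow>
     (\<forall>x0\<in>S. \<exists>\<delta>>0. \<forall>r. 0 < r \<and> r < \<delta> \<longrightarrow>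
        (\<exists>x \<in> cball x0 r \<inter> S. \<forall>z\<in>K.
           cball (f x z) (\<alpha> * r) \<subseteq> set_cball ((+) (f x0 z) ` C) r))"

definition metr_C_increasing ::
  "'b::real_normed_vector set \<Rightarrow> 'a::real_normed_vector set \<Rightarrow> ('a \<Rightarrow> 'a \<Rightarrow> 'b) \<Rightarrow> 'a set \<Rightarrow> bool"
  where
  "metr_C_increasing C K f S \<longleftrightarrow> (\<exists>\<alpha>>1. metr_C_increasing_const C K f S \<alpha>)"

definition inc ::
  "'b::real_normed_vector set \<Rightarrow> 'a::real_normed_vector set \<Rightarrow> ('a \<Rightarrow> 'a \<Rightarrow> 'b) \<Rightarrow> 'a set \<Rightarrow> ereal"
  where
  "inc C K f S = Sup {ereal \<alpha> | \<alpha>. \<alpha> > 1 \<and> metr_C_increasing_const C K f S \<alpha>}"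

(* Division in ereal gives \<infinity> / \<infinity> = 0, whereas here an infinite numerator takes precedence. *)
definition equot :: "ereal \<Rightarrow> ereal \<Rightarrow> ereal" where
  "equot a b = (if a = \<infinity> then \<infinity> else if b = \<infinity> then 0 else a / b)"

end

theory Submission
  imports Defs
begin

text \<open>
  The merit function \<open>\<nu>\<close> is lower semicontinuous on \<open>K\<close>, and its zeros in \<open>K\<close> are exactly the
  strong equilibria. The excess of a closed ball of radius \<open>s\<close> around a point \<open>y\<close> outside a convex
  set \<open>C\<close> over \<open>C\<close> is the distance of \<open>y\<close> to \<open>C\<close> plus \<open>s\<close>, so metric increase with constant \<open>\<alpha>\<close>
  yields from every non-equilibrium \<open>x\<close> of finite merit a point \<open>y \<noteq> x\<close> of \<open>K\<close> with
  \<open>\<nu> y + (\<alpha> - 1) \<parallel>x - y\<parallel> \<le> \<nu> x\<close>. Hence the point that Ekeland's variational principle produces from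
  \<open>x\<close> is an equilibrium within \<open>\<nu> x / (\<alpha> - 1)\<close> of \<open>x\<close>.
\<close>

section \<open>Ekeland's variational principle in a complete metric space\<close>

text \<open>The sets in \<open>cl\<close> are nested along a sequence of near-minimisers and shrink
  to a single point, which exists by completeness. Lower semicontinuity is encoded as closedness of
  these sets, and \<open>D\<close> can be the set where an extended-valued function is
  finite.\<close>

lemma ekeland_variational_principle:
  fixes \<phi> :: "'a::complete_space \<Rightarrow> real"
  assumes "c > 0" and bdd: "bdd_below (\<phi> ` D)"
    and cl: "\<And>x. x \<in> D \<Longrightarrow> closed {y \<in> D. \<phi> y + c * dist x y \<le> \<phi> x}"
    and "x \<in> D"
  obtains w where "w \<in> D" "\<phi> w + c * dist x w \<le> \<phi> x"
    "\<And>y. \<lbrakk>y \<in> D; \<phi> y + c * dist w y \<le> \<phi> w\<rbrakk> \<Longrightarrow> y = w"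
proof -
  define S where "S u = {y \<in> D. \<phi> y + c * dist u y \<le> \<phi> u}" for u
  have S_refl: "u \<in> S u" if "u \<in> D" for u
    using that by (simp add: S_def)
  have S_D: "v \<in> D" if "v \<in> S u" for u v
    using that by (simp add: S_def)
  have S_trans: "w \<in> S u" if "v \<in> S u" "w \<in> S v" for u v w
  proof -
    have "c * dist u w \<le> c * (dist u v + dist v w)"
      using \<open>c > 0\<close> by (intro mult_left_mono dist_triangle) auto
    then show ?thesis using that by (auto simp: S_def distrib_left)
  qed
  have step: "\<exists>v. v \<in> S u \<and> (\<forall>z\<in>S u. \<phi> v \<le> \<phi> z + (1/2) ^ n)" if "u \<in> D" for u and n :: nat
  proof -
    have bdd': "bdd_below (\<phi> ` S u)"
      by (rule bdd_below_mono[OF bdd]) (auto simp: S_def)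
    have "\<exists>t\<in>\<phi> ` S u. t < Inf (\<phi> ` S u) + (1/2) ^ n"
      using S_refl[OF that] by (intro cInf_lessD) auto
    then obtain v where v: "v \<in> S u" "\<phi> v < Inf (\<phi> ` S u) + (1/2) ^ n"
      by blast
    have "Inf (\<phi> ` S u) \<le> \<phi> z" if "z \<in> S u" for z
      using bdd' that by (intro cInf_lower) auto
    with v show ?thesis by fastforce
  qed
  have "\<exists>X. \<forall>n::nat. (X n \<in> D \<and> (n = 0 \<longrightarrow> X n = x)) \<and>
      (X (Suc n) \<in> S (X n) \<and> (\<forall>z\<in>S (X n). \<phi> (X (Suc n)) \<le> \<phi> z + (1/2) ^ n))"
    by (rule dependent_nat_choice) (use \<open>x \<in> D\<close> step S_D in \<open>blast+\<close>)
  then obtain X where X: "\<And>n. X n \<in> D" "X 0 = x" "\<And>n. X (Suc n) \<in> S (X n)"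
    "\<And>n z. z \<in> S (X n) \<Longrightarrow> \<phi> (X (Suc n)) \<le> \<phi> z + (1/2) ^ n"
    by blast
  have mono: "X n \<in> S (X m)" if "m \<le> n" for m n
    using that by (induction n rule: dec_induct) (auto intro: S_refl S_trans X)
  \<comment> \<open>As a member of \<open>S (X n)\<close>, \<open>z\<close> improves on the
    near-minimiser \<open>X (Suc n)\<close> by at most \<open>(1/2) ^ n\<close>; as a member of
    \<open>S (X (Suc n))\<close> it improves by at least \<open>c\<close> times the
    distance.\<close>
  have small: "dist (X (Suc n)) z \<le> (1/2) ^ n / c" if "z \<in> S (X (Suc n))" for n z
  proof -
    have "\<phi> (X (Suc n)) \<le> \<phi> z + (1/2) ^ n"
      using S_trans[OF X(3) that] by (rule X(4))
    moreover have "\<phi> z + c * dist (X (Suc n)) z \<le> \<phi> (X (Suc n))"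
      using that by (simp add: S_def)
    ultimately have "c * dist (X (Suc n)) z \<le> (1/2) ^ n"
      by linarith
    then show ?thesis using \<open>c > 0\<close> by (simp add: field_simps)
  qed
  have lim0: "(\<lambda>n. (1/2::real) ^ n / c) \<longlonglongrightarrow> 0"
    by (intro tendsto_divide_zero LIMSEQ_power_zero) simp
  have "Cauchy X"
  proof (rule metric_CauchyI)
    fix e :: real assume "e > 0"
    then have "\<forall>\<^sub>F n in sequentially. (1/2::real) ^ n / c < e / 2"
      using lim0 by (intro order_tendstoD) auto
    then obtain N where N: "(1/2::real) ^ N / c < e / 2"
      by (auto simp: eventually_sequentially)
    have near: "dist (X (Suc N)) (X m) < e / 2" if "m \<ge> Suc N" for m
      using small[OF mono[OF that]] N by linarith
    have "dist (X m) (X n) < e" if "m \<ge> Suc N" "n \<ge> Suc N" for m n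
      using near[OF that(1)] near[OF that(2)] by (metis dist_commute dist_triangle_half_r)
    then show "\<exists>M. \<forall>m\<ge>M. \<forall>n\<ge>M. dist (X m) (X n) < e" by blast
  qed
  then obtain w where w: "X \<longlonglongrightarrow> w"
    using Cauchy_convergent convergent_def by blast
  have w_S: "w \<in> S (X n)" for n
  proof (rule closed_sequentially)
    show "closed (S (X n))" unfolding S_def by (rule cl[OF X(1)])
    show "X (k + n) \<in> S (X n)" for k by (rule mono) simp
    show "(\<lambda>k. X (k + n)) \<longlonglongrightarrow> w" using w by (rule LIMSEQ_ignore_initial_segment)
  qed
  show ?thesis
  proof
    show "w \<in> D" "\<phi> w + c * dist x w \<le> \<phi> x"
      using w_S[of 0] X(2) by (auto simp: S_def)
    fix y assume "y \<in> D" "\<phi> y + c * dist w y \<le> \<phi> w"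
    \<comment> \<open>By transitivity \<open>y\<close> lies in every \<open>S (X (Suc n))\<close>,
      so it is a second limit of the same sequence.\<close>
    then have "y \<in> S w" by (simp add: S_def)
    then have "dist (X (Suc n)) y \<le> (1/2) ^ n / c" for n
      by (intro small S_trans[OF w_S])
    then have "(\<lambda>n. dist (X (Suc n)) y) \<longlonglongrightarrow> 0"
      by (intro tendsto_sandwich[OF _ _ tendsto_const lim0]) auto
    then have "(\<lambda>n. X (Suc n)) \<longlonglongrightarrow> y"
      by (simp add: tendsto_dist_iff[of _ y])
    then show "y = w" using LIMSEQ_Suc[OF w] by (rule LIMSEQ_unique)
  qed
qed

section \<open>Distances to convex sets and cones\<close>

lemma edist_set_eq_infdist:
  assumes "S \<noteq> {}"
  shows "edist_set x S = ereal (infdist x S)"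
proof -
  have "(INF s\<in>S. ereal (dist x s)) \<ge> 0"
    by (rule INF_greatest) simp
  moreover obtain s where "s \<in> S" using assms by blast
  then have "(INF s\<in>S. ereal (dist x s)) \<le> ereal (dist x s)"
    by (rule INF_lower)
  ultimately have "\<bar>INF s\<in>S. ereal (dist x s)\<bar> \<noteq> \<infinity>" by auto
  from ereal_INF[OF this] show ?thesis
    using assms by (simp add: edist_set_def infdist_notempty dist_norm)
qed

lemma mem_set_cball_iff: "S \<noteq> {} \<Longrightarrow> y \<in> set_cball S r \<longleftrightarrow> infdist y S \<le> r"
  by (simp add: set_cball_def edist_set_eq_infdist)

lemma le_infdistI:
  assumes "S \<noteq> {}" "\<And>s. s \<in> S \<Longrightarrow> d \<le> dist x s"
  shows "d \<le> infdist x S"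
  using assms by (auto simp: infdist_notempty intro!: cINF_greatest)

text \<open>Translation by \<open>c\<close> maps \<open>C\<close> into itself, so each
  \<open>s\<close> in \<open>C\<close> yields the competitor \<open>s + c\<close> at the same
  distance.\<close>

lemma infdist_add_convex_cone_le:
  fixes C :: "'b::real_normed_vector set"
  assumes "convex_cone C" "c \<in> C"
  shows "infdist (y + c) C \<le> infdist y C"
proof (rule le_infdistI)
  show "C \<noteq> {}" using assms by auto
  fix s assume "s \<in> C"
  have "infdist (y + c) C \<le> dist (y + c) (s + c)"
    using assms \<open>s \<in> C\<close> by (intro infdist_le convex_cone_add)
  then show "infdist (y + c) C \<le> dist y s" by simp
qed

text \<open>Points of \<open>y + C\<close> are no farther from \<open>C\<close> than
  \<open>y\<close> is; the rest is the triangle inequality.\<close>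

lemma infdist_convex_cone_le_translate:
  fixes C :: "'b::real_normed_vector set"
  assumes "convex_cone C"
  shows "infdist w C \<le> infdist y C + infdist w ((+) y ` C)"
proof -
  have "infdist w C - infdist y C \<le> infdist w ((+) y ` C)"
  proof (rule le_infdistI)
    show "(+) y ` C \<noteq> {}" using convex_cone_nonempty[OF assms] by simp
    fix s assume "s \<in> (+) y ` C"
    then obtain c where "c \<in> C" "s = y + c" by blast
    then show "infdist w C - infdist y C \<le> dist w s"
      using infdist_triangle[of w C s] infdist_add_convex_cone_le[OF assms, of c y] by simp
  qed
  then show ?thesis by simp
qed

text \<open>With \<open>d = infdist y C\<close>, moving \<open>y\<close> by \<open>s\<close>
  straight away from a point of \<open>C\<close> at distance \<open>n\<close> raises the distance to
  \<open>C\<close> to at least \<open>d * (n + s) / n\<close>, by convexity. This tends to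
  \<open>d + s\<close> as \<open>n\<close> tends to \<open>d\<close>, so no nearest point has to
  exist. If \<open>y\<close> were in \<open>C\<close>, the whole ball could lie in \<open>C\<close>;
  hence the positive distance.\<close>

lemma infdist_add_le_of_cball_subset:
  fixes C :: "'b::real_normed_vector set"
  assumes "convex C" "C \<noteq> {}" "infdist y C > 0" "s \<ge> 0"
    and ball: "\<And>w. w \<in> cball y s \<Longrightarrow> infdist w C \<le> \<rho>"
  shows "infdist y C + s \<le> \<rho>"
proof -
  define d where "d = infdist y C"
  have d: "d > 0" using assms by (simp add: d_def)
  have "d \<le> \<rho>" using ball[of y] assms by (simp add: d_def)
  have key: "d * s \<le> (\<rho> - d) * dist y p" if "p \<in> C" for p
  proof -
    define n where "n = dist y p"
    have "d \<le> n" using that by (simp add: d_def n_def infdist_le)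
    with d have n: "n > 0" by simp
    \<comment> \<open>Push \<open>y\<close> away from \<open>p\<close>; then \<open>y\<close> is a convex combination of \<open>w\<close> and \<open>p\<close>.\<close>
    define w where "w = y + (s / n) *\<^sub>R (y - p)"
    have "norm (y - w) = s"
      using n \<open>s \<ge> 0\<close> by (simp add: w_def n_def dist_norm)
    then have w: "w \<in> cball y s" by (simp add: dist_norm)
    define l where "l = n / (n + s)"
    have l: "0 < l" "l \<le> 1" using n \<open>s \<ge> 0\<close> by (auto simp: l_def)
    have ls: "l + l * (s / n) = 1"
    proof -
      have "l + l * (s / n) = l * ((n + s) / n)"
        using n by (simp add: field_simps)
      also have "\<dots> = 1" using n \<open>s \<ge> 0\<close> by (simp add: l_def)
      finally show ?thesis .
    qed
    \<comment> \<open>The homothety with centre \<open>p\<close> and ratio \<open>l\<close> takes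
      \<open>w\<close> to \<open>y\<close> and \<open>c\<close> to the subtracted point.\<close>
    have y_eq: "y - (l *\<^sub>R c + (1 - l) *\<^sub>R p) = l *\<^sub>R (w - c)" for c
    proof -
      have "l *\<^sub>R w = (l + l * (s / n)) *\<^sub>R y - (l * (s / n)) *\<^sub>R p"
        by (simp add: w_def algebra_simps)
      also have "\<dots> = y - (1 - l) *\<^sub>R p"
        unfolding ls using ls by (simp add: eq_diff_eq[THEN iffD2, of "l * (s / n)" l 1] add.commute)
      finally show ?thesis by (simp add: algebra_simps)
    qed
    have "d / l \<le> infdist w C"
    proof (rule le_infdistI)
      fix c assume "c \<in> C"
      then have "l *\<^sub>R c + (1 - l) *\<^sub>R p \<in> C"
        using l that \<open>convex C\<close> by (intro convexD) auto
      then have "d \<le> norm (y - (l *\<^sub>R c + (1 - l) *\<^sub>R p))"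
        unfolding d_def dist_norm[symmetric] by (rule infdist_le)
      also have "\<dots> = l * dist w c"
        using l by (simp add: y_eq dist_norm)
      finally show "d / l \<le> dist w c"
        using l by (simp add: field_simps)
    qed (use assms in auto)
    also have "\<dots> \<le> \<rho>" by (rule ball[OF w])
    finally show ?thesis
      using n \<open>s \<ge> 0\<close> by (simp add: l_def n_def[symmetric] field_simps)
  qed
  have "s \<le> \<rho> - d"
  \<comment> \<open>The other case divides by \<open>\<rho> - d\<close>; under equality
    \<open>key\<close> forces \<open>s = 0\<close>.\<close>
  proof (cases "\<rho> = d")
    case True
    obtain p where "p \<in> C" using assms by blast
    from key[OF this] True have "d * s \<le> 0" by simp
    with d True show ?thesis by (simp add: mult_le_0_iff)
  next
    case False
    with \<open>d \<le> \<rho>\<close> have pos: "\<rho> - d > 0" by simp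
    \<comment> \<open>By \<open>key\<close> this quotient is a lower bound for all distances from
      \<open>y\<close> to points of \<open>C\<close>, hence for their infimum
      \<open>d\<close>.\<close>
    have "d * s / (\<rho> - d) \<le> d"
      unfolding d_def using key pos assms(2)
      by (intro le_infdistI) (auto simp: d_def field_simps)
    then have "d * s \<le> d * (\<rho> - d)" using pos by (simp add: pos_divide_le_eq)
    then show ?thesis using d by simp
  qed
  then show ?thesis by (simp add: d_def)
qed

section \<open>Lower semicontinuity and sublevel sets of the merit function\<close>

text \<open>Near \<open>x\<close>, \<open>g u = v - c\<close> with \<open>v\<close> close to
  \<open>g x\<close>. Adding \<open>c\<close> back cannot increase the distance to \<open>C\<close>,
  so \<open>g u\<close> is at least as far from \<open>C\<close> as \<open>v\<close>.\<close>

lemma C_usc_at_imp_lsc_infdist: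
  fixes C :: "'b::real_normed_vector set"
  assumes "convex_cone C" "C_usc_at C g x" "e > 0"
  shows "\<forall>\<^sub>F u in nhds x. infdist (g x) C - e \<le> infdist (g u) C"
proof -
  have "\<forall>\<^sub>F y in nhds (g x). y \<in> ball (g x) e"
    using assms(3) by (intro eventually_nhds_in_open) auto
  with assms(2) have "\<forall>\<^sub>F u in nhds x. g u \<in> {v - c | v c. v \<in> ball (g x) e \<and> c \<in> C}"
    unfolding C_usc_at_def by blast
  then show ?thesis
  proof eventually_elim
    case (elim u)
    then obtain v c where v: "g u = v - c" "dist (g x) v < e" "c \<in> C" by auto
    have "infdist v C \<le> infdist (g u) C"
      using infdist_add_convex_cone_le[OF assms(1) v(3), of "g u"] v(1) by simp
    with infdist_triangle[of "g x" C v] v(2) show ?case by linarith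
  qed
qed

lemma merit_le_ereal_iff:
  assumes "C \<noteq> {}"
  shows "merit C K f x \<le> ereal t \<longleftrightarrow> (\<forall>z\<in>K. infdist (f x z) C \<le> t)"
  using assms by (simp add: merit_def SUP_le_iff edist_set_eq_infdist)

lemma merit_nonneg:
  assumes "C \<noteq> {}" "K \<noteq> {}"
  shows "0 \<le> merit C K f x"
proof -
  obtain z where "z \<in> K" using assms by blast
  then have "ereal (infdist (f x z) C) \<le> merit C K f x"
    using assms by (auto simp: merit_def edist_set_eq_infdist intro: SUP_upper)
  moreover have "0 \<le> ereal (infdist (f x z) C)" by (simp add: infdist_nonneg)
  ultimately show ?thesis by (rule order_trans[rotated])
qed

lemma mem_strong_equilibria_iff_merit:
  fixes C :: "'b::real_normed_vector set"
  assumes "closed C" "C \<noteq> {}"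
  shows "x \<in> strong_equilibria C K f \<longleftrightarrow> x \<in> K \<and> merit C K f x \<le> 0"
proof -
  have "infdist y C \<le> 0 \<longleftrightarrow> y \<in> C" for y
    using in_closed_iff_infdist_zero[OF assms, of y] infdist_nonneg[of y C] by auto
  then show ?thesis
    using merit_le_ereal_iff[OF assms(2), of K f x 0]
    by (simp add: strong_equilibria_def zero_ereal_def)
qed

text \<open>The level \<open>h\<close> varies so as to cover both the zero set of the merit and the
  sets required by Ekeland's principle, where \<open>h\<close> decreases linearly with the distance.
  Lower semicontinuity for each single \<open>z\<close> suffices, as the merit is a
  supremum.\<close>

lemma closed_merit_le:
  fixes C :: "'b::real_normed_vector set" and h :: "'a::real_normed_vector \<Rightarrow> real"
  assumes "convex_cone C" "closed K" "continuous_on UNIV h"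
    and usc: "\<And>z. z \<in> K \<Longrightarrow> C_usc_on C K (\<lambda>x. f x z)"
  shows "closed {x \<in> K. merit C K f x \<le> ereal (h x)}"
  unfolding closed_sequential_limits
proof (intro allI impI, elim conjE)
  fix X l assume X: "\<forall>n. X n \<in> {x \<in> K. merit C K f x \<le> ereal (h x)}" and lim: "X \<longlonglongrightarrow> l"
  note iff = merit_le_ereal_iff[OF convex_cone_nonempty[OF assms(1)]]
  have "l \<in> K" using X lim \<open>closed K\<close> closed_sequentially by blast
  moreover have "infdist (f l z) C \<le> h l" if "z \<in> K" for z
  proof (rule field_le_epsilon)
    fix e :: real assume "e > 0"
    have "C_usc_at C (\<lambda>x. f x z) l" using usc that \<open>l \<in> K\<close> by (auto simp: C_usc_on_def)
    from C_usc_at_imp_lsc_infdist[OF assms(1) this \<open>e > 0\<close>] lim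
    have "\<forall>\<^sub>F n in sequentially. infdist (f l z) C - e \<le> infdist (f (X n) z) C"
      by (rule eventually_compose_filterlim)
    then have "\<forall>\<^sub>F n in sequentially. infdist (f l z) C - e \<le> h (X n)"
    proof eventually_elim
      case (elim n)
      have "infdist (f (X n) z) C \<le> h (X n)" using X that by (auto simp: iff)
      with elim show ?case by linarith
    qed
    moreover have "(\<lambda>n. h (X n)) \<longlonglongrightarrow> h l"
      using assms(3) lim by (auto intro: continuous_on_tendsto_compose)
    ultimately have "infdist (f l z) C - e \<le> h l"
      by (intro tendsto_lowerbound) auto
    then show "infdist (f l z) C \<le> h l + e" by simp
  qed
  ultimately show "l \<in> {x \<in> K. merit C K f x \<le> ereal (h x)}" by (auto simp: iff)
qed

section \<open>Decrease of the merit and equilibria near a given point\<close>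

lemma metr_C_increasing_const_decrease:
  fixes C :: "'b::real_normed_vector set" and K :: "'a::real_normed_vector set"
  assumes "closed C" "convex_cone C" "\<alpha> > 1"
    and inc: "metr_C_increasing_const C K f (K - strong_equilibria C K f) \<alpha>"
    and x: "x \<in> K - strong_equilibria C K f" and t: "merit C K f x = ereal t"
  obtains y where "y \<in> K" "y \<noteq> x" "merit C K f y \<le> ereal (t - (\<alpha> - 1) * dist x y)"
proof -
  have "C \<noteq> {}" and "convex C" using assms(2) by (auto simp: convex_cone_def)
  note iff = merit_le_ereal_iff[OF \<open>C \<noteq> {}\<close>]
  note eq_iff = mem_strong_equilibria_iff_merit[OF assms(1) \<open>C \<noteq> {}\<close>, where K = K and f = f]
  obtain \<delta> where \<delta>: "\<delta> > 0" "\<And>r. 0 < r \<and> r < \<delta> \<Longrightarrow>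
      \<exists>y \<in> cball x r \<inter> (K - strong_equilibria C K f). \<forall>z\<in>K.
        cball (f y z) (\<alpha> * r) \<subseteq> set_cball ((+) (f x z) ` C) r"
    using inc x unfolding metr_C_increasing_const_def by metis
  define r where "r = \<delta> / 2"
  have r: "0 < r" "r < \<delta>" using \<delta>(1) by (auto simp: r_def)
  then obtain y where y: "dist x y \<le> r" "y \<in> K" "y \<notin> strong_equilibria C K f"
    and sub: "\<And>z. z \<in> K \<Longrightarrow> cball (f y z) (\<alpha> * r) \<subseteq> set_cball ((+) (f x z) ` C) r"
    using \<delta>(2)[of r] by auto
  have fx: "infdist (f x z) C \<le> t" if "z \<in> K" for z
    using iff[of K f x t] t that by simp
  have dec: "infdist (f y z) C + \<alpha> * r \<le> t + r" if "z \<in> K" "infdist (f y z) C > 0" for z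
  proof (rule infdist_add_le_of_cball_subset[OF \<open>convex C\<close> \<open>C \<noteq> {}\<close> that(2)])
    show "0 \<le> \<alpha> * r" using r \<open>\<alpha> > 1\<close> by simp
    fix w assume "w \<in> cball (f y z) (\<alpha> * r)"
    with sub[OF that(1)] have "infdist w ((+) (f x z) ` C) \<le> r"
      using mem_set_cball_iff[of "(+) (f x z) ` C" w r] \<open>C \<noteq> {}\<close> \<open>w \<in> _\<close> by blast
    with infdist_convex_cone_le_translate[OF assms(2), of w "f x z"] fx[OF that(1)]
    show "infdist w C \<le> t + r" by linarith
  qed
  \<comment> \<open>\<open>dec\<close> is silent about those \<open>z\<close> with zero distance.
    Since \<open>y\<close> is again no equilibrium, some \<open>z0\<close> has positive distance,
    which makes the target bound nonnegative and so settles them.\<close>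
  have "\<not> merit C K f y \<le> ereal 0" using y eq_iff by (simp add: zero_ereal_def)
  then obtain z0 where z0: "z0 \<in> K" "infdist (f y z0) C > 0"
    by (auto simp: iff not_le)
  have nonneg: "0 \<le> t - (\<alpha> - 1) * r"
    using dec[OF z0] z0(2) by (simp add: algebra_simps)
  have my: "merit C K f y \<le> ereal (t - (\<alpha> - 1) * r)"
    unfolding iff
  proof
    fix z assume "z \<in> K"
    show "infdist (f y z) C \<le> t - (\<alpha> - 1) * r"
    proof (cases "infdist (f y z) C > 0")
      case True
      from dec[OF \<open>z \<in> K\<close> this] show ?thesis by (simp add: algebra_simps)
    qed (use nonneg in linarith)
  qed
  show ?thesis
  proof
    \<comment> \<open>The merit falls strictly, so \<open>y\<close> differs from \<open>x\<close>;
      as \<open>dist x y \<le> r\<close>, the drop dominates the multiple of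
      \<open>dist x y\<close>.\<close>
    have "(\<alpha> - 1) * r > 0" using r \<open>\<alpha> > 1\<close> by simp
    with my t show "y \<noteq> x" by auto
    have "(\<alpha> - 1) * dist x y \<le> (\<alpha> - 1) * r"
      using y(1) \<open>\<alpha> > 1\<close> by (intro mult_left_mono) auto
    then have "ereal (t - (\<alpha> - 1) * r) \<le> ereal (t - (\<alpha> - 1) * dist x y)" by simp
    with my show "merit C K f y \<le> ereal (t - (\<alpha> - 1) * dist x y)" by (rule order_trans)
  qed (fact y(2))
qed

lemma strong_equilibrium_near:
  fixes C :: "'b::real_normed_vector set" and K :: "'a::banach set"
  assumes "closed C" "convex_cone C" "closed K"
    and usc: "\<And>z. z \<in> K \<Longrightarrow> C_usc_on C K (\<lambda>x. f x z)"
    and "\<alpha> > 1" and inc: "metr_C_increasing_const C K f (K - strong_equilibria C K f) \<alpha>"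
    and "x \<in> K" and t: "merit C K f x = ereal t"
  obtains w where "w \<in> strong_equilibria C K f" "(\<alpha> - 1) * dist x w \<le> t"
proof -
  have "C \<noteq> {}" "K \<noteq> {}" using convex_cone_nonempty assms(2,7) by auto
  \<comment> \<open>Outside \<open>D\<close> the real-valued \<open>\<phi>\<close> would take the
    default value 0 of \<open>real_of_ereal\<close> at infinity and create false minimisers.\<close>
  define D where "D = {y \<in> K. merit C K f y \<noteq> \<infinity>}"
  define \<phi> where "\<phi> y = real_of_ereal (merit C K f y)" for y
  have nonneg: "0 \<le> merit C K f y" for y
    using \<open>C \<noteq> {}\<close> \<open>K \<noteq> {}\<close> by (rule merit_nonneg)
  have \<phi>: "merit C K f y = ereal (\<phi> y)" if "y \<in> D" for y
    using that nonneg[of y] by (cases "merit C K f y") (auto simp: D_def \<phi>_def)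
  have \<phi>_nonneg: "0 \<le> \<phi> y" for y
    using nonneg[of y] by (simp add: \<phi>_def real_of_ereal_pos)
  \<comment> \<open>A real bound on the merit already puts \<open>y\<close> in \<open>D\<close>, so
    Ekeland's sets are sublevel sets of the merit in \<open>K\<close>.\<close>
  have D_iff: "y \<in> D \<and> \<phi> y + (\<alpha> - 1) * dist u y \<le> \<phi> u \<longleftrightarrow>
      y \<in> K \<and> merit C K f y \<le> ereal (\<phi> u - (\<alpha> - 1) * dist u y)" for u y
    using \<phi>[of y] by (cases "y \<in> D") (auto simp: D_def)
  have "x \<in> D" using \<open>x \<in> K\<close> t by (simp add: D_def)
  have closed: "closed {y \<in> D. \<phi> y + (\<alpha> - 1) * dist u y \<le> \<phi> u}" for u
    unfolding D_iff
    by (rule closed_merit_le[OF assms(2,3) _ usc]) (auto intro!: continuous_intros)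
  have "bdd_below (\<phi> ` D)" using \<phi>_nonneg by (auto intro!: bdd_belowI[of _ 0])
  moreover have "\<alpha> - 1 > 0" using \<open>\<alpha> > 1\<close> by simp
  ultimately obtain w where w: "w \<in> D" "\<phi> w + (\<alpha> - 1) * dist x w \<le> \<phi> x"
    and min: "\<And>y. \<lbrakk>y \<in> D; \<phi> y + (\<alpha> - 1) * dist w y \<le> \<phi> w\<rbrakk> \<Longrightarrow> y = w"
    using ekeland_variational_principle[of "\<alpha> - 1" \<phi> D x] closed \<open>x \<in> D\<close> by blast
  show ?thesis
  proof
    show "w \<in> strong_equilibria C K f"
    proof (rule ccontr)
      assume "w \<notin> strong_equilibria C K f"
      with w have "w \<in> K - strong_equilibria C K f" by (simp add: D_def)
      then obtain y where "y \<in> K" "y \<noteq> w" "merit C K f y \<le> ereal (\<phi> w - (\<alpha> - 1) * dist w y)"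
        using metr_C_increasing_const_decrease[OF assms(1,2,5) inc _ \<phi>[OF w(1)]] by blast
      with D_iff[of y w] min[of y] show False by blast
    qed
    show "(\<alpha> - 1) * dist x w \<le> t"
      using w(2) \<phi>_nonneg[of w] t by (simp add: \<phi>_def)
  qed
qed

section \<open>Existence, closedness and the error bound with the supremal constant\<close>

theorem corollary3p4:
  fixes C :: "'b::banach set" and K :: "'a::banach set" and f :: "'a \<Rightarrow> 'a \<Rightarrow> 'b"
  assumes "closed C" and "convex_cone C" and "{0} \<noteq> C" and "C \<noteq> UNIV"
    and "K \<noteq> {}" and "closed K"
    and "\<And>z. z \<in> K \<Longrightarrow> C_usc_on C K (\<lambda>x. f x z)"
    and "\<exists>x0\<in>K. C_bounded C (f x0 ` K)"
    and "metr_C_increasing C K f (K - strong_equilibria C K f)"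
  shows "strong_equilibria C K f \<noteq> {} \<and> closed (strong_equilibria C K f) \<and>
    (\<forall>x\<in>K. edist_set x (strong_equilibria C K f)
        \<le> equot (merit C K f x) (inc C K f (K - strong_equilibria C K f) - 1))"
proof (intro conjI ballI)
  let ?E = "strong_equilibria C K f"
  let ?A = "{\<alpha>. \<alpha> > 1 \<and> metr_C_increasing_const C K f (K - ?E) \<alpha>}"
  have "C \<noteq> {}" using assms(2) by (rule convex_cone_nonempty)
  have inc_eq: "inc C K f (K - ?E) = (SUP \<alpha>\<in>?A. ereal \<alpha>)"
    unfolding inc_def by (rule arg_cong[where f = Sup]) auto
  obtain \<beta> where \<beta>: "\<beta> \<in> ?A" using assms(9) by (auto simp: metr_C_increasing_def)
  have near: "\<exists>w\<in>?E. (\<alpha> - 1) * dist x w \<le> t"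
    if "\<alpha> \<in> ?A" "x \<in> K" "merit C K f x = ereal t" for \<alpha> x t
    using strong_equilibrium_near[OF assms(1,2,6), of f \<alpha> x t] assms(7) that by blast
  obtain x0 m where x0: "x0 \<in> K" "m \<ge> 0" "f x0 ` K - C \<subseteq> cball 0 m"
    using assms(8) by (auto simp: C_bounded_def)
  have "infdist (f x0 z) C \<le> m" if "z \<in> K" for z
  proof (cases "f x0 z \<in> C")
    \<comment> \<open>Values outside \<open>C\<close> have norm at most \<open>m\<close>, and
      \<open>0\<close> lies in \<open>C\<close>; thus the merit of \<open>x0\<close> is
      finite.\<close>
    case False
    with x0(3) that have "dist (f x0 z) 0 \<le> m" by (auto simp: dist_commute)
    with convex_cone_contains_0[OF assms(2)] show ?thesis by (rule infdist_le2)
  qed (use x0 in simp)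
  then have "merit C K f x0 \<le> ereal m"
    by (simp add: merit_le_ereal_iff[OF \<open>C \<noteq> {}\<close>])
  with merit_nonneg[OF \<open>C \<noteq> {}\<close> assms(5), of f x0]
  obtain t where "merit C K f x0 = ereal t"
    by (cases "merit C K f x0") auto
  from near[OF \<beta> x0(1) this] show "?E \<noteq> {}" by auto
  have "?E = {x \<in> K. merit C K f x \<le> ereal 0}"
    using mem_strong_equilibria_iff_merit[OF assms(1) \<open>C \<noteq> {}\<close>, of _ K f]
    by (auto simp: zero_ereal_def)
  also have "closed \<dots>"
    by (rule closed_merit_le[OF assms(2,6) _ assms(7)]) auto
  finally show "closed ?E" .
  fix x assume "x \<in> K"
  let ?i = "inc C K f (K - ?E)"
  define d where "d = infdist x ?E"
  have ed: "edist_set x ?E = ereal d"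
    unfolding d_def by (rule edist_set_eq_infdist[OF \<open>?E \<noteq> {}\<close>])
  have "d \<ge> 0" by (simp add: d_def infdist_nonneg)
  show "edist_set x ?E \<le> equot (merit C K f x) (?i - 1)"
  proof (cases "merit C K f x")
    case (real t)
    \<comment> \<open>The equilibrium \<open>w\<close> depends on \<open>\<alpha>\<close>, but
      \<open>d\<close> does not, so the supremum over \<open>\<alpha>\<close> can be taken
      afterwards.\<close>
    have bound: "(\<alpha> - 1) * d \<le> t" if \<alpha>: "\<alpha> \<in> ?A" for \<alpha>
    proof -
      obtain w where w: "w \<in> ?E" "(\<alpha> - 1) * dist x w \<le> t"
        using near[OF \<alpha> \<open>x \<in> K\<close> real] by blast
      have "(\<alpha> - 1) * d \<le> (\<alpha> - 1) * dist x w"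
        unfolding d_def using \<alpha> w(1) by (intro mult_left_mono infdist_le) auto
      with w(2) show ?thesis by linarith
    qed
    show ?thesis
    \<comment> \<open>For \<open>d = 0\<close> the constant may be infinite, and the quotient need
      only be nonnegative. For \<open>d > 0\<close>, \<open>bound\<close> caps every
      \<open>\<alpha>\<close> at \<open>t / d + 1\<close>, so the constant is finite and the
      division is an ordinary one.\<close>
    proof (cases "d = 0")
      case True
      have "t \<ge> 0" using bound[OF \<beta>] True by simp
      moreover have "?i \<ge> 1"
        using SUP_upper[OF \<beta>, of ereal] \<beta> unfolding inc_eq
        by (auto simp: one_ereal_def intro: order_trans[rotated])
      ultimately show ?thesis
        using True ed real by (cases ?i) (auto simp: equot_def one_ereal_def)
    next
      case False
      with \<open>d \<ge> 0\<close> have "d > 0" by simp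
      have le: "?i \<le> ereal (t / d + 1)"
        unfolding inc_eq using bound \<open>d > 0\<close>
        by (intro SUP_least) (auto simp: field_simps)
      have "ereal \<beta> \<le> ?i" unfolding inc_eq by (rule SUP_upper[OF \<beta>])
      with le obtain i where i: "?i = ereal i" "\<beta> \<le> i" "i \<le> t / d + 1"
        by (cases ?i) auto
      then have "i > 1" using \<beta> by simp
      have "d \<le> t / (i - 1)"
        using i \<open>d > 0\<close> \<open>i > 1\<close> by (simp add: field_simps)
      then show ?thesis
        using i real ed \<open>i > 1\<close> by (simp add: equot_def one_ereal_def)
    qed
  \<comment> \<open>Infinite merit makes the right-hand side infinite by convention; minus infinity
    is excluded by nonnegativity.\<close>
  qed (use merit_nonneg[OF \<open>C \<noteq> {}\<close> assms(5), of f x] in \<open>auto simp: equot_def\<close>)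
qed

end
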